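(* Let $r,s\ge1$ and let $G$ be an $s$-regular graph. If $\big(PM(G),\,C_s(PM(G))\big)$ is an $(r,s)$-loom, then both hypergraphs $PM(G)$ and $C_s(PM(G))$ have perfect fractional matchings.
   Context: All graphs and hypergraphs are finite. For a graph $G$, $PM(G)$ is the hypergraph with ground set $E(G)$ whose edges are the perfect matchings of $G$ (each viewed as a subset of $E(G)$). A hypergraph $H$ is a set of subsets (edges) of a set of vertices; it is $r$-uniform if all its edges have size $r$. A cover of $H$ is a set of vertices (here, for $PM(G)$, a subset of $E(G)$) meeting every edge of $H$; $\tau(H)$ is the minimum size of a cover, and $C_k(H)$ is the set of covers of $H$ of size exactly $k$. A pair $(A,B)$ of hypergraphs is orthogonal if $|a\cap b|=1$ for all $a\in A$, $b\in B$. For integers $r,s\ge 1$, an $(r,s)$-loom is a pair $(A,B)$ of orthogonal hypergraphs such that $A$ is $r$-uniform, $B$ is $s$-uniform, $\tau(A)=s$, $\tau(B)=r$, $A=C_r(B)$ and $B=C_s(A)$. A fractional matching of a hypergraph $H$ is a function $f:H\to\mathbb{R}_{\ge0}$ on its edges with $\sum_{e\in H:\,v\in e}f(e)\le1$ for every vertex $v$; it is perfect if equality holds for every vertex $v$. *)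

theory Defs
  imports Complex_Main "HOL-Library.Extended_Nat"
begin

text \<open>
  A hypergraph is given by a finite ground set \<open>X\<close> together with a set \<open>H\<close> of subsets of \<open>X\<close>.
  The ground set is carried explicitly, because covers and perfect fractional matchings refer
  to it and it may be larger than \<open>\<Union>H\<close>.
\<close>

definition hypergraph :: "'v set \<Rightarrow> 'v set set \<Rightarrow> bool" where
  "hypergraph X H \<longleftrightarrow> finite X \<and> (\<forall>e\<in>H. e \<subseteq> X)"

definition uniform :: "nat \<Rightarrow> 'v set set \<Rightarrow> bool" where
  "uniform r H \<longleftrightarrow> (\<forall>e\<in>H. card e = r)"

definition cover :: "'v set \<Rightarrow> 'v set set \<Rightarrow> 'v set \<Rightarrow> bool" where
  "cover X H C \<longleftrightarrow> C \<subseteq> X \<and> (\<forall>e\<in>H. C \<inter> e \<noteq> {})"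

text \<open>A hypergraph containing the empty edge has no cover; its covering number is then \<open>\<infinity>\<close>.\<close>

definition tau :: "'v set \<Rightarrow> 'v set set \<Rightarrow> enat" where
  "tau X H = (INF C\<in>{C. cover X H C}. enat (card C))"

definition covers_of_size :: "'v set \<Rightarrow> nat \<Rightarrow> 'v set set \<Rightarrow> 'v set set" where
  "covers_of_size X k H = {C. cover X H C \<and> card C = k}"

definition orthogonal :: "'v set set \<Rightarrow> 'v set set \<Rightarrow> bool" where
  "orthogonal A B \<longleftrightarrow> (\<forall>a\<in>A. \<forall>b\<in>B. card (a \<inter> b) = 1)"

definition loom :: "'v set \<Rightarrow> nat \<Rightarrow> nat \<Rightarrow> 'v set set \<Rightarrow> 'v set set \<Rightarrow> bool" where
  "loom X r s A B \<longleftrightarrow>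
     hypergraph X A \<and> hypergraph X B \<and> orthogonal A B \<and>
     uniform r A \<and> uniform s B \<and>
     tau X A = enat s \<and> tau X B = enat r \<and>
     A = covers_of_size X r B \<and> B = covers_of_size X s A"

text \<open>Only the values of \<open>f\<close> on \<open>H\<close> matter.\<close>

definition fractional_matching :: "'v set \<Rightarrow> 'v set set \<Rightarrow> ('v set \<Rightarrow> real) \<Rightarrow> bool" where
  "fractional_matching X H f \<longleftrightarrow>
     (\<forall>e\<in>H. 0 \<le> f e) \<and> (\<forall>v\<in>X. (\<Sum>e\<in>{e\<in>H. v \<in> e}. f e) \<le> 1)"

definition perfect_fractional_matching ::
    "'v set \<Rightarrow> 'v set set \<Rightarrow> ('v set \<Rightarrow> real) \<Rightarrow> bool" where
  "perfect_fractional_matching X H f \<longleftrightarrow>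
     fractional_matching X H f \<and> (\<forall>v\<in>X. (\<Sum>e\<in>{e\<in>H. v \<in> e}. f e) = 1)"

text \<open>Finite simple graphs, with edges as two-element sets of vertices.\<close>

definition simple_graph :: "'a set \<Rightarrow> 'a set set \<Rightarrow> bool" where
  "simple_graph V E \<longleftrightarrow> finite V \<and> (\<forall>e\<in>E. e \<subseteq> V \<and> card e = 2)"

definition regular_graph :: "'a set \<Rightarrow> 'a set set \<Rightarrow> nat \<Rightarrow> bool" where
  "regular_graph V E s \<longleftrightarrow> (\<forall>v\<in>V. card {e\<in>E. v \<in> e} = s)"

definition perfect_matching :: "'a set \<Rightarrow> 'a set set \<Rightarrow> 'a set set \<Rightarrow> bool" where
  "perfect_matching V E M \<longleftrightarrow> M \<subseteq> E \<and> (\<forall>v\<in>V. \<exists>!e. e \<in> M \<and> v \<in> e)"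

text \<open>The edge set of the hypergraph \<open>PM(G)\<close>, whose ground set is \<open>E\<close>.\<close>

definition PM :: "'a set \<Rightarrow> 'a set set \<Rightarrow> 'a set set set" where
  "PM V E = {M. perfect_matching V E M}"

end

theory Submission
  imports Defs
begin

text \<open>
  Giving every vertex star the weight \<open>1/2\<close> yields a perfect fractional matching of the covers.
  For \<open>PM(G)\<close>, an odd cut meets every perfect matching, so it is a cover and has at least
  \<open>\<tau> = s\<close> edges. It remains to prove Edmonds' theorem: a weighting of the edges of a multigraph in
  which all vertices have weighted degree \<open>t\<close> and all odd cuts have weight at least \<open>t\<close> is a
  nonnegative combination of perfect matchings. Induct on the number of vertices plus edges. An edge
  of weight zero is deleted; a tight odd cut with at least two vertices on each side allows one to
  contract either side and to glue the two decompositions along the cut. Otherwise, if there are at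
  least six vertices, all degrees are at least three, so there are more edges than vertices and some
  nonzero \<open>z\<close> sums to zero around each vertex; moving along \<open>z\<close> and \<open>-z\<close> until an edge vanishes or
  an odd cut becomes tight exhibits \<open>w\<close> as a convex combination of two reducible weightings. With at
  most four vertices, all odd cuts are vertex stars, and a perfect matching can be peeled off directly.
\<close>

section \<open>Multigraphs, odd cut conditions and nonnegative decompositions\<close>

text \<open>Edges are names with a map \<open>\<phi>\<close> to their ends, because contraction
  creates parallel edges. The names survive contraction, so weights and matchings carry over without
  renaming.\<close>

definition multigraph :: "'a set \<Rightarrow> 'e set \<Rightarrow> ('e \<Rightarrow> 'a set) \<Rightarrow> bool" where
  "multigraph V E \<phi> \<longleftrightarrow> finite V \<and> finite E \<and> (\<forall>e\<in>E. \<phi> e \<subseteq> V \<and> card (\<phi> e) = 2)"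

definition edge_cut :: "'e set \<Rightarrow> ('e \<Rightarrow> 'a set) \<Rightarrow> 'a set \<Rightarrow> 'e set" where
  "edge_cut E \<phi> S = {e \<in> E. \<phi> e \<inter> S \<noteq> {} \<and> \<phi> e - S \<noteq> {}}"

definition perfect_matchings :: "'a set \<Rightarrow> 'e set \<Rightarrow> ('e \<Rightarrow> 'a set) \<Rightarrow> 'e set set" where
  "perfect_matchings V E \<phi> = {M. M \<subseteq> E \<and> (\<forall>v\<in>V. \<exists>!e. e \<in> M \<and> v \<in> \<phi> e)}"

text \<open>For \<open>t = 1\<close> these are Edmonds' inequalities for the perfect matching
  polytope. A general \<open>t\<close> lets a multiple of a perfect matching be subtracted.\<close>

definition odd_cut_weighting ::
    "'a set \<Rightarrow> 'e set \<Rightarrow> ('e \<Rightarrow> 'a set) \<Rightarrow> ('e \<Rightarrow> real) \<Rightarrow> real \<Rightarrow> bool" where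
  "odd_cut_weighting V E \<phi> w t \<longleftrightarrow>
     even (card V) \<and> (\<forall>e\<in>E. 0 \<le> w e) \<and> (\<forall>v\<in>V. sum w (edge_cut E \<phi> {v}) = t) \<and>
     (\<forall>S\<subseteq>V. odd (card S) \<longrightarrow> t \<le> sum w (edge_cut E \<phi> S))"

text \<open>For finite \<open>P\<close>, this is membership of \<open>w\<close> in the cone spanned
  by the indicator vectors of the members of \<open>P\<close>; the coefficients are not
  normalised.\<close>

definition decomposable :: "'e set set \<Rightarrow> 'e set \<Rightarrow> ('e \<Rightarrow> real) \<Rightarrow> bool" where
  "decomposable P E w \<longleftrightarrow>
     (\<exists>f. (\<forall>M\<in>P. 0 \<le> f M) \<and> (\<forall>e\<in>E. (\<Sum>M\<in>{M\<in>P. e \<in> M}. f M) = w e))"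

lemma decomposable_mono:
  assumes "decomposable P E w" "P \<subseteq> Q" "finite Q"
  shows "decomposable Q E w"
proof -
  obtain f where f: "\<forall>M\<in>P. 0 \<le> f M" "\<forall>e\<in>E. (\<Sum>M\<in>{M\<in>P. e \<in> M}. f M) = w e"
    using assms(1) unfolding decomposable_def by blast
  let ?g = "\<lambda>M. if M \<in> P then f M else (0::real)"
  have "(\<Sum>M\<in>{M\<in>Q. e \<in> M}. ?g M) = (\<Sum>M\<in>{M\<in>P. e \<in> M}. f M)" for e
  proof -
    have "(\<Sum>M\<in>{M\<in>Q. e \<in> M}. ?g M) = (\<Sum>M\<in>{M\<in>P. e \<in> M}. ?g M)"
      using assms(2,3) by (intro sum.mono_neutral_right) auto
    then show ?thesis by simp
  qed
  then show ?thesis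
    unfolding decomposable_def using f by (intro exI[of _ ?g]) auto
qed

lemma decomposable_combine:
  assumes "decomposable P E u" "decomposable P E v" "0 \<le> a" "0 \<le> b"
    "\<And>e. e \<in> E \<Longrightarrow> w e = a * u e + b * v e"
  shows "decomposable P E w"
proof -
  obtain f g where f: "\<forall>M\<in>P. 0 \<le> f M" "\<forall>e\<in>E. (\<Sum>M\<in>{M\<in>P. e \<in> M}. f M) = u e"
    and g: "\<forall>M\<in>P. 0 \<le> g M" "\<forall>e\<in>E. (\<Sum>M\<in>{M\<in>P. e \<in> M}. g M) = v e"
    using assms(1,2) unfolding decomposable_def by blast
  show ?thesis
    unfolding decomposable_def
    by (rule exI[of _ "\<lambda>M. a * f M + b * g M"])
      (use f g assms(3-5) in \<open>auto simp: sum.distrib simp flip: sum_distrib_left\<close>)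
qed

lemma decomposable_single:
  assumes "M \<in> P" "finite P"
  shows "decomposable P E (\<lambda>e. if e \<in> M then 1 else 0)"
  unfolding decomposable_def
proof (intro exI[of _ "\<lambda>N. if N = M then 1 else 0"] conjI ballI)
  fix e
  show "(\<Sum>N\<in>{N \<in> P. e \<in> N}. if N = M then 1 else 0) = (if e \<in> M then 1 else (0::real))"
    using assms by simp
qed simp

section \<open>Gluing two decompositions along shared edges\<close>

text \<open>Since \<open>M \<inter> D\<close> is a single edge, \<open>sum w (M \<inter> D)\<close> is the weight of that edge.\<close>

lemma glue_marginal:
  fixes w :: "'e \<Rightarrow> real"
  assumes P: "P = {M1 \<union> M2 |M1 M2. M1 \<in> P1 \<and> M2 \<in> P2 \<and> M1 \<inter> D = M2 \<inter> D}"
    and D: "D = E1 \<inter> E2"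
    and f1: "\<And>e. e \<in> E1 \<Longrightarrow> (\<Sum>M\<in>{M\<in>P1. e \<in> M}. f1 M) = w e"
    and f2: "\<And>e. e \<in> E2 \<Longrightarrow> (\<Sum>M\<in>{M\<in>P2. e \<in> M}. f2 M) = w e"
    and fin: "finite P1" "finite P2"
    and sub: "\<And>M. M \<in> P1 \<Longrightarrow> M \<subseteq> E1" "\<And>M. M \<in> P2 \<Longrightarrow> M \<subseteq> E2"
    and single1: "\<And>M. M \<in> P1 \<Longrightarrow> \<exists>c. M \<inter> D = {c}"
    and single2: "\<And>M. M \<in> P2 \<Longrightarrow> \<exists>c. M \<inter> D = {c}"
    and pos: "\<And>e. e \<in> D \<Longrightarrow> 0 < w e"
    and e: "e \<in> E1"
  shows "(\<Sum>M\<in>{M\<in>P. e \<in> M}. f1 (M \<inter> E1) * f2 (M \<inter> E2) / sum w (M \<inter> D)) = w e"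
proof -
  have un: "(M1 \<union> M2) \<inter> E1 = M1" "(M1 \<union> M2) \<inter> E2 = M2" "(M1 \<union> M2) \<inter> D = M1 \<inter> D"
    if "M1 \<in> P1" "M2 \<in> P2" "M1 \<inter> D = M2 \<inter> D" for M1 M2
    using sub(1)[OF that(1)] sub(2)[OF that(2)] that(3) D by blast+
  let ?f = "\<lambda>M. f1 (M \<inter> E1) * f2 (M \<inter> E2) / sum w (M \<inter> D)"
  have "(\<Sum>M\<in>{M\<in>P. e \<in> M}. ?f M) =
    (\<Sum>(M1, M2)\<in>Sigma {M1\<in>P1. e \<in> M1} (\<lambda>M1. {M2\<in>P2. M1 \<inter> D = M2 \<inter> D}).
      f1 M1 * f2 M2 / sum w (M1 \<inter> D))"
  proof (rule sum.reindex_bij_witness[of _ "\<lambda>(M1, M2). M1 \<union> M2" "\<lambda>M. (M \<inter> E1, M \<inter> E2)"])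
    fix M assume M: "M \<in> {M\<in>P. e \<in> M}"
    then obtain M1 M2 where M12: "M1 \<in> P1" "M2 \<in> P2" "M1 \<inter> D = M2 \<inter> D" "M = M1 \<union> M2"
      unfolding P by blast
    note u = un[OF M12(1-3), folded M12(4)]
    show "(\<lambda>(M1, M2). M1 \<union> M2) (M \<inter> E1, M \<inter> E2) = M" using u M12(4) by simp
    show "(M \<inter> E1, M \<inter> E2) \<in> Sigma {M1\<in>P1. e \<in> M1} (\<lambda>M1. {M2\<in>P2. M1 \<inter> D = M2 \<inter> D})"
      using u(1,2) M12(1-3) M e by auto
    show "(case (M \<inter> E1, M \<inter> E2) of (M1, M2) \<Rightarrow> f1 M1 * f2 M2 / sum w (M1 \<inter> D)) = ?f M"
      using u by simp
  next
    fix b assume "b \<in> Sigma {M1\<in>P1. e \<in> M1} (\<lambda>M1. {M2\<in>P2. M1 \<inter> D = M2 \<inter> D})"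
    then obtain M1 M2 where b: "b = (M1, M2)" "M1 \<in> P1" "e \<in> M1" "M2 \<in> P2" "M1 \<inter> D = M2 \<inter> D"
      by blast
    show "(\<lambda>M. (M \<inter> E1, M \<inter> E2)) ((\<lambda>(M1, M2). M1 \<union> M2) b) = b"
      using un[OF b(2,4,5)] b(1) by simp
    show "(\<lambda>(M1, M2). M1 \<union> M2) b \<in> {M\<in>P. e \<in> M}" unfolding P using b by auto
  qed
  also have "\<dots> = (\<Sum>M1\<in>{M1\<in>P1. e \<in> M1}. \<Sum>M2\<in>{M2\<in>P2. M1 \<inter> D = M2 \<inter> D}.
      f1 M1 * f2 M2 / sum w (M1 \<inter> D))"
    using fin by (subst sum.Sigma) auto
  also have "\<dots> = (\<Sum>M1\<in>{M1\<in>P1. e \<in> M1}. f1 M1)"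
  proof (rule sum.cong[OF refl])
    fix M1 assume "M1 \<in> {M1\<in>P1. e \<in> M1}"
    then have M1: "M1 \<in> P1" by simp
    obtain c where c: "M1 \<inter> D = {c}" using single1[OF M1] by blast
    \<comment> \<open>Both traces on \<open>D\<close> are single edges, so \<open>M2\<close> agrees
      with \<open>M1\<close> there exactly when it contains \<open>c\<close>.\<close>
    have set_eq: "{M2\<in>P2. M1 \<inter> D = M2 \<inter> D} = {M2\<in>P2. c \<in> M2}"
    proof (intro Collect_cong conj_cong refl)
      fix M2 assume "M2 \<in> P2"
      then obtain d where "M2 \<inter> D = {d}" using single2 by blast
      then show "(M1 \<inter> D = M2 \<inter> D) \<longleftrightarrow> c \<in> M2" using c by auto
    qed
    have cD: "c \<in> D" using c by blast
    \<comment> \<open>The members of \<open>P2\<close> through \<open>c\<close> have total weight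
      \<open>w c\<close>, which cancels the positive denominator.\<close>
    have "(\<Sum>M2\<in>{M2\<in>P2. c \<in> M2}. f1 M1 * f2 M2 / w c)
        = f1 M1 * (\<Sum>M2\<in>{M2\<in>P2. c \<in> M2}. f2 M2) / w c"
      by (simp add: sum_distrib_left sum_divide_distrib)
    also have "\<dots> = f1 M1" using f2[of c] cD D pos[OF cD] by simp
    finally show "(\<Sum>M2\<in>{M2\<in>P2. M1 \<inter> D = M2 \<inter> D}. f1 M1 * f2 M2 / sum w (M1 \<inter> D)) = f1 M1"
      using c unfolding set_eq by simp
  qed
  also have "\<dots> = w e" using f1 e by blast
  finally show ?thesis .
qed

text \<open>Given the shared edge \<open>c\<close>, the two sides are chosen independently: a pair
  gets weight \<open>f1 M1 * f2 M2 / w c\<close>. Both sides give \<open>c\<close> total weight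
  \<open>w c\<close>, so summing over one partner returns the coefficient of the other.\<close>

lemma decomposable_glue:
  assumes d1: "decomposable P1 E1 w" and d2: "decomposable P2 E2 w"
    and fin: "finite P1" "finite P2"
    and sub: "\<And>M. M \<in> P1 \<Longrightarrow> M \<subseteq> E1" "\<And>M. M \<in> P2 \<Longrightarrow> M \<subseteq> E2"
    and single1: "\<And>M. M \<in> P1 \<Longrightarrow> \<exists>c. M \<inter> (E1 \<inter> E2) = {c}"
    and single2: "\<And>M. M \<in> P2 \<Longrightarrow> \<exists>c. M \<inter> (E1 \<inter> E2) = {c}"
    and pos: "\<And>e. e \<in> E1 \<inter> E2 \<Longrightarrow> 0 < w e"
  shows "decomposable {M1 \<union> M2 |M1 M2. M1 \<in> P1 \<and> M2 \<in> P2 \<and> M1 \<inter> (E1 \<inter> E2) = M2 \<inter> (E1 \<inter> E2)}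
           (E1 \<union> E2) w" (is "decomposable ?P _ _")
proof -
  obtain f1 where f1: "\<forall>M\<in>P1. 0 \<le> f1 M" "\<forall>e\<in>E1. (\<Sum>M\<in>{M\<in>P1. e \<in> M}. f1 M) = w e"
    using d1 unfolding decomposable_def by blast
  obtain f2 where f2: "\<forall>M\<in>P2. 0 \<le> f2 M" "\<forall>e\<in>E2. (\<Sum>M\<in>{M\<in>P2. e \<in> M}. f2 M) = w e"
    using d2 unfolding decomposable_def by blast
  let ?D = "E1 \<inter> E2"
  let ?f = "\<lambda>M. f1 (M \<inter> E1) * f2 (M \<inter> E2) / sum w (M \<inter> ?D)"
  have un: "(M1 \<union> M2) \<inter> E1 = M1" "(M1 \<union> M2) \<inter> E2 = M2" "(M1 \<union> M2) \<inter> ?D = M1 \<inter> ?D"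
    if "M1 \<in> P1" "M2 \<in> P2" "M1 \<inter> ?D = M2 \<inter> ?D" for M1 M2
    using sub(1)[OF that(1)] sub(2)[OF that(2)] that(3) by blast+
  have nonneg: "0 \<le> ?f M" if M_in: "M \<in> ?P" for M
  proof -
    obtain M1 M2 where M: "M1 \<in> P1" "M2 \<in> P2" "M1 \<inter> ?D = M2 \<inter> ?D" "M = M1 \<union> M2"
      using M_in by blast
    have "0 \<le> sum w (M \<inter> ?D)" using pos by (intro sum_nonneg) (auto intro: less_imp_le)
    then show ?thesis using M(4) un[OF M(1-3)] f1(1) f2(1) M(1,2) by simp
  qed
  have side1: "(\<Sum>M\<in>{M\<in>?P. e \<in> M}. ?f M) = w e" if "e \<in> E1" for e
    by (rule glue_marginal[OF refl refl _ _ fin sub single1 single2 pos that]) (use f1(2) f2(2) in auto)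
  \<comment> \<open>The glued family is symmetric in the two sides, so \<open>glue_marginal\<close>
    applies again with the roles exchanged.\<close>
  have P': "?P = {M2 \<union> M1 |M2 M1. M2 \<in> P2 \<and> M1 \<in> P1 \<and> M2 \<inter> ?D = M1 \<inter> ?D}"
    by (auto simp: Un_commute)
  have side2: "(\<Sum>M\<in>{M\<in>?P. e \<in> M}. ?f M) = w e" if "e \<in> E2" for e
  proof -
    have "(\<Sum>M\<in>{M\<in>?P. e \<in> M}. f2 (M \<inter> E2) * f1 (M \<inter> E1) / sum w (M \<inter> ?D)) = w e"
      by (rule glue_marginal[OF P' Int_commute _ _ fin(2,1) sub(2,1) single2 single1 pos that])
        (use f1(2) f2(2) in auto)
    then show ?thesis by (simp only: mult.commute)
  qed
  show ?thesis
    unfolding decomposable_def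
    by (rule exI[of _ ?f]) (use nonneg side1 side2 in blast)
qed

section \<open>Linear algebra and affine families\<close>

text \<open>Gaussian elimination: each equation with a nonzero coefficient eliminates one unknown,
  and there are more unknowns than equations.\<close>

lemma underdetermined_system:
  fixes a :: "'v \<Rightarrow> 'e \<Rightarrow> real"
  assumes "finite V" "finite E" "card V < card E"
  shows "\<exists>z. (\<exists>e\<in>E. z e \<noteq> 0) \<and> (\<forall>v\<in>V. (\<Sum>e\<in>E. a v e * z e) = 0)"
  using assms
proof (induction V arbitrary: E a rule: finite_induct)
  case empty
  then have "E \<noteq> {}" by auto
  then show ?case by (intro exI[of _ "\<lambda>_. 1"]) auto
next
  case (insert v V)
  show ?case
  proof (cases "\<forall>e\<in>E. a v e = 0")
    case True
    have "card V < card E" using insert by simp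
    from insert.IH[OF insert.prems(1) this, of a] obtain z where
      "\<exists>e\<in>E. z e \<noteq> 0" "\<forall>v\<in>V. (\<Sum>e\<in>E. a v e * z e) = 0" by blast
    then show ?thesis using True by (intro exI[of _ z]) auto
  next
    case False
    then obtain p where p: "p \<in> E" "a v p \<noteq> 0" by blast
    let ?E = "E - {p}"
    \<comment> \<open>Row \<open>u\<close> after subtracting the multiple of row \<open>v\<close>
      that cancels the unknown \<open>p\<close>.\<close>
    let ?b = "\<lambda>u e. a u e - a u p * a v e / a v p"
    have "card V < card ?E" using insert p by simp
    from insert.IH[OF _ this, of ?b] insert.prems(1) obtain z where
      z: "\<exists>e\<in>?E. z e \<noteq> 0" "\<forall>u\<in>V. (\<Sum>e\<in>?E. ?b u e * z e) = 0" by blast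
    \<comment> \<open>The value of the unknown \<open>p\<close> forced by row
      \<open>v\<close>.\<close>
    let ?c = "- (\<Sum>e\<in>?E. a v e * z e) / a v p"
    let ?y = "z(p := ?c)"
    have split: "(\<Sum>e\<in>E. a u e * ?y e) = a u p * ?c + (\<Sum>e\<in>?E. a u e * z e)" for u
    proof -
      have "(\<Sum>e\<in>E. a u e * ?y e) = a u p * ?y p + (\<Sum>e\<in>?E. a u e * ?y e)"
        using insert.prems(1) p(1) by (rule sum.remove)
      moreover have "(\<Sum>e\<in>?E. a u e * ?y e) = (\<Sum>e\<in>?E. a u e * z e)"
        by (rule sum.cong) auto
      ultimately show ?thesis by simp
    qed
    have "(\<Sum>e\<in>E. a u e * ?y e) = 0" if "u \<in> V" for u
    proof -
      have "0 = (\<Sum>e\<in>?E. a u e * z e - (a u p / a v p) * (a v e * z e))"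
        using z(2) that by (simp add: algebra_simps)
      also have "\<dots> = (\<Sum>e\<in>?E. a u e * z e) - (a u p / a v p) * (\<Sum>e\<in>?E. a v e * z e)"
        by (simp add: sum_subtractf sum_distrib_left)
      finally show ?thesis unfolding split by simp
    qed
    moreover have "(\<Sum>e\<in>E. a v e * ?y e) = 0" unfolding split using p(2) by simp
    ultimately show ?thesis using z(1) by (intro exI[of _ ?y]) auto
  qed
qed

text \<open>A pair stands for the constraint \<open>0 \<le> c + l * d\<close>. Take \<open>l\<close>
  as the least \<open>- c / d\<close> over pairs with negative slope; \<open>(c', d')\<close>
  ensures that there is one.\<close>

lemma first_zero_of_affine_family:
  fixes Q :: "(real \<times> real) set"
  assumes "finite Q" "\<forall>(c, d)\<in>Q. 0 < c" "(c', d') \<in> Q" "d' < 0"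
  shows "\<exists>l>0. (\<forall>(c, d)\<in>Q. 0 \<le> c + l * d) \<and> (\<exists>(c, d)\<in>Q. c + l * d = 0)"
proof -
  let ?R = "{(c, d). (c, d) \<in> Q \<and> d < 0}"
  let ?L = "(\<lambda>(c, d). - c / d) ` ?R"
  have fin: "finite ?L"
    by (intro finite_imageI finite_subset[OF _ assms(1)]) auto
  have ne: "?L \<noteq> {}" using assms(3,4) by auto
  let ?l = "Min ?L"
  have "?l \<in> ?L" using Min_in[OF fin ne] .
  then obtain c d where cd: "(c, d) \<in> Q" "d < 0" "?l = - c / d" by auto
  have l: "0 < ?l" using cd bspec[OF assms(2) cd(1)] by (simp add: divide_pos_neg)
  have "0 \<le> c' + ?l * d'" if "(c', d') \<in> Q" for c' d'
  proof (cases "d' < 0")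
    case True
    then have "- c' / d' \<in> ?L" using that by force
    then have "?l \<le> - c' / d'" using fin by (rule Min_le[rotated])
    then show ?thesis using True by (simp add: field_simps)
  next
    case False
    then show ?thesis using l bspec[OF assms(2) that] by (simp add: add_nonneg_nonneg less_imp_le)
  qed
  moreover have "c + ?l * d = 0" using cd by simp
  ultimately show ?thesis using l cd(1) by (intro exI[of _ ?l]) auto
qed

section \<open>Cuts and perfect matchings\<close>

lemma edge_cut_singleton:
  assumes "multigraph V E \<phi>"
  shows "edge_cut E \<phi> {v} = {e \<in> E. v \<in> \<phi> e}"
proof -
  have "\<phi> e - {v} \<noteq> {}" if "e \<in> E" for e
  proof
    assume "\<phi> e - {v} = {}"
    then have "card (\<phi> e) \<le> card {v}" by (intro card_mono) auto
    then show False using assms that unfolding multigraph_def by auto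
  qed
  then show ?thesis unfolding edge_cut_def by auto
qed

lemma edge_cut_complement:
  assumes "multigraph V E \<phi>" "S \<subseteq> V"
  shows "edge_cut E \<phi> (V - S) = edge_cut E \<phi> S"
  using assms unfolding edge_cut_def multigraph_def by blast

text \<open>Exchange the sums: an edge counts once for each of its ends in \<open>S\<close>, hence
  twice inside \<open>S\<close> and once across the cut.\<close>

lemma handshake:
  fixes w :: "'e \<Rightarrow> real"
  assumes mg: "multigraph V E \<phi>" and S: "S \<subseteq> V"
  shows "(\<Sum>v\<in>S. sum w (edge_cut E \<phi> {v})) = 2 * sum w {e \<in> E. \<phi> e \<subseteq> S} + sum w (edge_cut E \<phi> S)"
proof -
  have finE: "finite E" and finS: "finite S"
    using mg S finite_subset unfolding multigraph_def by auto
  have "(\<Sum>v\<in>S. sum w (edge_cut E \<phi> {v})) = (\<Sum>v\<in>S. \<Sum>e\<in>E. if v \<in> \<phi> e then w e else 0)"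
    unfolding edge_cut_singleton[OF mg] using finE by (simp add: sum.inter_filter)
  also have "\<dots> = (\<Sum>e\<in>E. \<Sum>v\<in>S. if v \<in> \<phi> e then w e else 0)"
    by (rule sum.swap)
  also have "\<dots> = (\<Sum>e\<in>E. 2 * (if \<phi> e \<subseteq> S then w e else 0) +
      (if \<phi> e \<inter> S \<noteq> {} \<and> \<phi> e - S \<noteq> {} then w e else 0))"
  proof (rule sum.cong[OF refl])
    fix e assume "e \<in> E"
    then have "card (\<phi> e) = 2" using mg unfolding multigraph_def by blast
    then obtain x y where xy: "\<phi> e = {x, y}" "x \<noteq> y" by (meson card_2_iff)
    have "(\<Sum>v\<in>S. if v \<in> \<phi> e then w e else 0) = (\<Sum>v\<in>S \<inter> {x, y}. w e)"
      unfolding xy(1) by (rule sum.inter_restrict[OF finS, symmetric])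
    also have "\<dots> = (if x \<in> S then w e else 0) + (if y \<in> S then w e else 0)"
      using xy(2) by (auto simp: Int_insert_right)
    finally show "(\<Sum>v\<in>S. if v \<in> \<phi> e then w e else 0) = 2 * (if \<phi> e \<subseteq> S then w e else 0) +
      (if \<phi> e \<inter> S \<noteq> {} \<and> \<phi> e - S \<noteq> {} then w e else 0)"
      unfolding xy(1) by auto
  qed
  also have "\<dots> = 2 * sum w {e \<in> E. \<phi> e \<subseteq> S} + sum w (edge_cut E \<phi> S)"
    unfolding edge_cut_def using finE by (simp add: sum.distrib sum.inter_filter sum_distrib_left)
  finally show ?thesis .
qed

lemma finite_perfect_matchings:
  "multigraph V E \<phi> \<Longrightarrow> finite (perfect_matchings V E \<phi>)"
  unfolding multigraph_def perfect_matchings_def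
  by (rule finite_subset[of _ "Pow E"]) auto

lemma cut_perfect_matching_singleton:
  assumes "multigraph V E \<phi>" "M \<in> perfect_matchings V E \<phi>" "v \<in> V"
  shows "\<exists>c. M \<inter> edge_cut E \<phi> {v} = {c}"
  using assms(2,3) unfolding edge_cut_singleton[OF assms(1)] perfect_matchings_def by blast

lemma sum_indicator_perfect_matching:
  assumes "multigraph V E \<phi>" "M \<in> perfect_matchings V E \<phi>" "v \<in> V"
  shows "(\<Sum>e\<in>edge_cut E \<phi> {v}. if e \<in> M then 1 else 0) = (1::real)"
proof -
  obtain c where c: "M \<inter> edge_cut E \<phi> {v} = {c}"
    using cut_perfect_matching_singleton[OF assms] by blast
  have "finite (edge_cut E \<phi> {v})" using assms(1) unfolding multigraph_def edge_cut_def by simp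
  then have "(\<Sum>e\<in>edge_cut E \<phi> {v}. if e \<in> M then 1 else 0) = real (card (edge_cut E \<phi> {v} \<inter> M))"
    by (simp add: sum.inter_restrict[symmetric])
  also have "edge_cut E \<phi> {v} \<inter> M = {c}" using c by blast
  finally show ?thesis by simp
qed

text \<open>Apply \<open>handshake\<close> to the indicator of \<open>M\<close>: if no edge of
  \<open>M\<close> crossed, \<open>card S\<close> would be twice the number of edges of
  \<open>M\<close> inside \<open>S\<close>.\<close>

lemma perfect_matching_meets_odd_cut:
  assumes mg: "multigraph V E \<phi>" and M: "M \<in> perfect_matchings V E \<phi>"
    and S: "S \<subseteq> V" "odd (card S)"
  shows "edge_cut E \<phi> S \<inter> M \<noteq> {}"
proof
  assume "edge_cut E \<phi> S \<inter> M = {}"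
  then have zero: "(\<Sum>e\<in>edge_cut E \<phi> S. if e \<in> M then 1 else (0::real)) = 0"
    by (intro sum.neutral) auto
  have "finite {e \<in> E. \<phi> e \<subseteq> S}" using mg unfolding multigraph_def by simp
  then have "(\<Sum>e\<in>{e \<in> E. \<phi> e \<subseteq> S}. if e \<in> M then 1 else (0::real))
      = real (card ({e \<in> E. \<phi> e \<subseteq> S} \<inter> M))"
    by (simp add: sum.inter_restrict[symmetric])
  moreover have "(\<Sum>v\<in>S. \<Sum>e\<in>edge_cut E \<phi> {v}. if e \<in> M then 1 else (0::real)) = (\<Sum>v\<in>S. 1)"
    using sum_indicator_perfect_matching[OF mg M] S(1) by (intro sum.cong) auto
  ultimately have "real (card S) = 2 * real (card ({e \<in> E. \<phi> e \<subseteq> S} \<inter> M))"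
    using handshake[OF mg S(1), of "\<lambda>e. if e \<in> M then 1 else 0"] zero by simp
  then have "card S = 2 * card ({e \<in> E. \<phi> e \<subseteq> S} \<inter> M)" by linarith
  then show False using S(2) by simp
qed


section \<open>Contraction of one side of a tight odd cut\<close>

text \<open>The contracted vertex is represented by a member \<open>s\<close> of \<open>S\<close>,
  so no new vertex type arises and the new vertex set is \<open>insert s (V - S)\<close>.\<close>

definition contract :: "'a set \<Rightarrow> 'a \<Rightarrow> 'a \<Rightarrow> 'a" where
  "contract S s x = (if x \<in> S then s else x)"

text \<open>An edge inside \<open>S\<close> has both ends sent to \<open>s\<close>, so dropping it
  never affects a cut. Cut conditions of the contracted graph thus become conditions on preimages in
  the original one.\<close>

lemma edge_cut_contract:
  assumes "multigraph V E \<phi>"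
  shows "edge_cut {e \<in> E. \<not> \<phi> e \<subseteq> S} (\<lambda>e. contract S s ` \<phi> e) T
    = edge_cut E \<phi> {x \<in> V. contract S s x \<in> T}"
proof -
  have sub: "\<phi> e \<subseteq> V" if "e \<in> E" for e
    using assms that unfolding multigraph_def by blast
  show ?thesis
  proof (intro set_eqI iffI)
    fix e assume "e \<in> edge_cut {e \<in> E. \<not> \<phi> e \<subseteq> S} (\<lambda>e. contract S s ` \<phi> e) T"
    then show "e \<in> edge_cut E \<phi> {x \<in> V. contract S s x \<in> T}"
      using sub unfolding edge_cut_def by blast
  next
    fix e assume e: "e \<in> edge_cut E \<phi> {x \<in> V. contract S s x \<in> T}"
    then obtain x y where xy: "e \<in> E" "x \<in> \<phi> e" "contract S s x \<in> T"
      "y \<in> \<phi> e" "contract S s y \<notin> T"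
      using sub unfolding edge_cut_def by blast
    then have "\<not> \<phi> e \<subseteq> S" unfolding contract_def by (metis subsetD)
    then show "e \<in> edge_cut {e \<in> E. \<not> \<phi> e \<subseteq> S} (\<lambda>e. contract S s ` \<phi> e) T"
      using xy unfolding edge_cut_def by blast
  qed
qed

text \<open>A kept edge has at most one end in \<open>S\<close>, so its ends stay distinct.\<close>

lemma multigraph_contract:
  assumes "multigraph V E \<phi>" "s \<in> S"
  shows "multigraph (insert s (V - S)) {e \<in> E. \<not> \<phi> e \<subseteq> S} (\<lambda>e. contract S s ` \<phi> e)"
  unfolding multigraph_def
proof (intro conjI ballI)
  fix e assume e: "e \<in> {e \<in> E. \<not> \<phi> e \<subseteq> S}"
  then have sub: "\<phi> e \<subseteq> V" and c: "card (\<phi> e) = 2" and n: "\<not> \<phi> e \<subseteq> S"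
    using assms(1) unfolding multigraph_def by auto
  show "contract S s ` \<phi> e \<subseteq> insert s (V - S)"
    using sub unfolding contract_def by auto
  have "inj_on (contract S s) (\<phi> e)"
  proof -
    obtain x y where "\<phi> e = {x, y}" "x \<noteq> y" using c by (meson card_2_iff)
    then show ?thesis using n assms(2) unfolding contract_def inj_on_def by auto
  qed
  then show "card (contract S s ` \<phi> e) = 2" using c by (simp add: card_image)
qed (use assms in \<open>auto simp: multigraph_def\<close>)

text \<open>The degree of the new vertex is the weight of the tight cut. Taking preimages replaces
  \<open>s\<close> by the odd set \<open>S\<close>, which preserves parity, so odd cuts come from
  odd cuts.\<close>

lemma odd_cut_weighting_contract:
  assumes mg: "multigraph V E \<phi>" and w: "odd_cut_weighting V E \<phi> w t"
    and S: "S \<subseteq> V" "s \<in> S" "odd (card S)" and tight: "sum w (edge_cut E \<phi> S) = t"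
  shows "odd_cut_weighting (insert s (V - S)) {e \<in> E. \<not> \<phi> e \<subseteq> S} (\<lambda>e. contract S s ` \<phi> e) w t"
proof -
  have finV: "finite V" using mg unfolding multigraph_def by blast
  have finS: "finite S" using finV S(1) by (rule finite_subset[rotated])
  have cardV: "card V = card (V - S) + card S"
    using card_Diff_subset[OF finS S(1)] card_mono[OF finV S(1)] by simp
  have pre: "{x \<in> V. contract S s x \<in> T} = (if s \<in> T then T - {s} \<union> S else T)"
    if "T \<subseteq> insert s (V - S)" for T
    using that S(1,2) unfolding contract_def by auto
  have par: "odd (card {x \<in> V. contract S s x \<in> T})"
    if T: "T \<subseteq> insert s (V - S)" "odd (card T)" for T
  proof (cases "s \<in> T")
    case True
    have finT: "finite T" by (rule finite_subset[OF T(1)]) (use finV in simp)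
    have "card (T - {s} \<union> S) = card (T - {s}) + card S"
      using finT finS T(1) by (intro card_Un_disjoint) auto
    moreover have "even (card (T - {s}))"
      using card.remove[OF finT True] T(2) by (metis even_Suc)
    ultimately have "odd (card (T - {s} \<union> S))" using S(3) by simp
    then show ?thesis using pre[OF T(1)] True by simp
  next
    case False
    then show ?thesis using pre[OF T(1)] T(2) by simp
  qed
  have "card (insert s (V - S)) = Suc (card (V - S))"
    using finV S(2) by simp
  then have "even (card (insert s (V - S)))"
    using w S(3) cardV unfolding odd_cut_weighting_def by simp
  moreover have "sum w (edge_cut E \<phi> {x \<in> V. contract S s x \<in> {v}}) = t"
    if "v \<in> insert s (V - S)" for v
  proof (cases "v = s")
    case True
    then have "{x \<in> V. contract S s x \<in> {v}} = S"
      using pre[of "{s}"] S(1,2) by auto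
    then show ?thesis using tight by simp
  next
    case False
    then have "{x \<in> V. contract S s x \<in> {v}} = {v}"
      using pre[of "{v}"] that by simp
    then show ?thesis using w that False unfolding odd_cut_weighting_def by auto
  qed
  moreover have "t \<le> sum w (edge_cut E \<phi> {x \<in> V. contract S s x \<in> T})"
    if "T \<subseteq> insert s (V - S)" "odd (card T)" for T
    using w par[OF that] unfolding odd_cut_weighting_def by auto
  ultimately show ?thesis
    using w unfolding odd_cut_weighting_def edge_cut_contract[OF mg] by auto
qed

text \<open>Edges of \<open>M2\<close> at a vertex outside \<open>S\<close> are not contained in
  \<open>S\<close>, hence belong to \<open>M1\<close>; so \<open>M1\<close> alone decides what
  covers \<open>v\<close>. Used once for each side of the cut.\<close>

lemma perfect_matching_glue_half:
  assumes M1: "M1 \<in> perfect_matchings (insert s (V - S)) {e \<in> E. \<not> \<phi> e \<subseteq> S} (\<lambda>e. contract S s ` \<phi> e)"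
    and M2: "M2 \<inter> {e \<in> E. \<not> \<phi> e \<subseteq> S} \<subseteq> M1" "M2 \<subseteq> E"
    and v: "v \<in> V" "v \<notin> S" and s: "s \<in> S"
  shows "\<exists>!e. e \<in> M1 \<union> M2 \<and> v \<in> \<phi> e"
proof -
  have "v \<in> contract S s ` A \<longleftrightarrow> v \<in> A" for A
    using v s unfolding contract_def by (auto simp: image_iff)
  moreover have "\<exists>!e. e \<in> M1 \<and> v \<in> contract S s ` \<phi> e"
    using M1 v unfolding perfect_matchings_def by blast
  ultimately have "\<exists>!e. e \<in> M1 \<and> v \<in> \<phi> e" by simp
  moreover have "e \<in> M1" if "e \<in> M2" "v \<in> \<phi> e" for e
    using that M2 v by blast
  ultimately show ?thesis by blast
qed

text \<open>The edges kept by both contractions are those crossing the cut, and they form the star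
  of the new vertex in each contracted graph. Every matching on either side therefore uses exactly
  one of them, as \<open>decomposable_glue\<close> requires.\<close>

lemma decomposable_of_tight_cut:
  assumes mg: "multigraph V E \<phi>" and pos: "\<And>e. e \<in> E \<Longrightarrow> 0 < w e"
    and S: "S \<subseteq> V" "s \<in> S" "s' \<in> V - S"
    and d1: "decomposable (perfect_matchings (insert s (V - S)) {e \<in> E. \<not> \<phi> e \<subseteq> S}
      (\<lambda>e. contract S s ` \<phi> e)) {e \<in> E. \<not> \<phi> e \<subseteq> S} w"
    and d2: "decomposable (perfect_matchings (insert s' (V - (V - S))) {e \<in> E. \<not> \<phi> e \<subseteq> V - S}
      (\<lambda>e. contract (V - S) s' ` \<phi> e)) {e \<in> E. \<not> \<phi> e \<subseteq> V - S} w"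
  shows "decomposable (perfect_matchings V E \<phi>) E w"
proof -
  let ?E1 = "{e \<in> E. \<not> \<phi> e \<subseteq> S}" and ?E2 = "{e \<in> E. \<not> \<phi> e \<subseteq> V - S}"
  let ?P1 = "perfect_matchings (insert s (V - S)) ?E1 (\<lambda>e. contract S s ` \<phi> e)"
  let ?P2 = "perfect_matchings (insert s' (V - (V - S))) ?E2 (\<lambda>e. contract (V - S) s' ` \<phi> e)"
  let ?D = "?E1 \<inter> ?E2"
  note mg1 = multigraph_contract[OF mg S(2)]
  note mg2 = multigraph_contract[OF mg S(3)]
  have ends: "\<phi> e \<subseteq> V" "\<phi> e \<noteq> {}" if "e \<in> E" for e
    using mg that unfolding multigraph_def by fastforce+
  have D: "?D = edge_cut E \<phi> S"
    using ends unfolding edge_cut_def by blast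
  have "{x \<in> V. contract S s x \<in> {s}} = S"
    using S unfolding contract_def by auto
  then have D1: "edge_cut ?E1 (\<lambda>e. contract S s ` \<phi> e) {s} = ?D"
    unfolding edge_cut_contract[OF mg] D by simp
  have "{x \<in> V. contract (V - S) s' x \<in> {s'}} = V - S"
    using S unfolding contract_def by auto
  then have D2: "edge_cut ?E2 (\<lambda>e. contract (V - S) s' ` \<phi> e) {s'} = ?D"
    unfolding edge_cut_contract[OF mg] D using edge_cut_complement[OF mg S(1)] by simp
  have E: "?E1 \<union> ?E2 = E" using ends by blast
  have "decomposable {M1 \<union> M2 |M1 M2. M1 \<in> ?P1 \<and> M2 \<in> ?P2 \<and> M1 \<inter> ?D = M2 \<inter> ?D} (?E1 \<union> ?E2) w"
  proof (rule decomposable_glue[OF d1 d2 finite_perfect_matchings[OF mg1]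
        finite_perfect_matchings[OF mg2]])
    show "\<exists>c. M \<inter> ?D = {c}" if "M \<in> ?P1" for M
      using cut_perfect_matching_singleton[OF mg1 that, of s] unfolding D1 by blast
    show "\<exists>c. M \<inter> ?D = {c}" if "M \<in> ?P2" for M
      using cut_perfect_matching_singleton[OF mg2 that, of s'] unfolding D2 by blast
  qed (use pos in \<open>auto simp: perfect_matchings_def\<close>)
  moreover have "{M1 \<union> M2 |M1 M2. M1 \<in> ?P1 \<and> M2 \<in> ?P2 \<and> M1 \<inter> ?D = M2 \<inter> ?D}
      \<subseteq> perfect_matchings V E \<phi>"
  proof clarify
    fix M1 M2 assume M: "M1 \<in> ?P1" "M2 \<in> ?P2" "M1 \<inter> ?D = M2 \<inter> ?D"
    have sub: "M1 \<subseteq> ?E1" "M2 \<subseteq> ?E2" using M(1,2) unfolding perfect_matchings_def by blast+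
    have "\<exists>!e. e \<in> M1 \<union> M2 \<and> v \<in> \<phi> e" if v: "v \<in> V" for v
    proof (cases "v \<in> S")
      case False
      show ?thesis
        by (rule perfect_matching_glue_half[OF M(1) _ _ v False S(2)]) (use M(3) sub in blast)+
    next
      case True
      have "\<exists>!e. e \<in> M2 \<union> M1 \<and> v \<in> \<phi> e"
        by (rule perfect_matching_glue_half[OF M(2) _ _ v _ S(3)]) (use M(3) sub True in blast)+
      then show ?thesis by (simp only: Un_commute)
    qed
    then show "M1 \<union> M2 \<in> perfect_matchings V E \<phi>"
      using sub unfolding perfect_matchings_def by blast
  qed
  ultimately show ?thesis
    using finite_perfect_matchings[OF mg] unfolding E by (rule decomposable_mono)
qed

section \<open>Zero edges and perturbation of weightings\<close>

lemma decomposable_of_zero_edge: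
  assumes mg: "multigraph V E \<phi>" and p: "w p = 0"
    and d: "decomposable (perfect_matchings V (E - {p}) \<phi>) (E - {p}) w"
  shows "decomposable (perfect_matchings V E \<phi>) E w"
proof (rule decomposable_mono)
  let ?P = "perfect_matchings V (E - {p}) \<phi>"
  have "{M \<in> ?P. p \<in> M} = {}" unfolding perfect_matchings_def by blast
  then have "(\<Sum>M\<in>{M \<in> ?P. p \<in> M}. f M) = w p" for f
    using p by (simp only: sum.empty)
  then show "decomposable ?P E w"
    using d unfolding decomposable_def by blast
  show "?P \<subseteq> perfect_matchings V E \<phi>" unfolding perfect_matchings_def by blast
qed (rule finite_perfect_matchings[OF mg])

lemma odd_cut_weighting_delete:
  assumes mg: "multigraph V E \<phi>" and w: "odd_cut_weighting V E \<phi> w t" and p: "w p = 0"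
  shows "odd_cut_weighting V (E - {p}) \<phi> w t"
proof -
  have "sum w (edge_cut (E - {p}) \<phi> S) = sum w (edge_cut E \<phi> S)" for S
    using mg p by (intro sum.mono_neutral_left) (auto simp: edge_cut_def multigraph_def)
  then show ?thesis using w unfolding odd_cut_weighting_def by simp
qed

text \<open>As \<open>card V\<close> is even, both sides are odd, so the small side is a single
  vertex and the cut is its star. Only degrees enter, so the lemma also serves weightings still
  being checked for the cut conditions.\<close>

lemma trivial_odd_cut:
  assumes mg: "multigraph V E \<phi>" and deg: "\<And>v. v \<in> V \<Longrightarrow> sum w (edge_cut E \<phi> {v}) = t"
    and "even (card V)" and S: "S \<subseteq> V" "odd (card S)" and triv: "card S \<le> 1 \<or> card (V - S) \<le> 1"
  shows "sum w (edge_cut E \<phi> S) = t"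
proof -
  have finV: "finite V" using mg unfolding multigraph_def by blast
  have finS: "finite S" using finV S(1) by (rule finite_subset[rotated])
  have "card V = card (V - S) + card S"
    using card_Diff_subset[OF finS S(1)] card_mono[OF finV S(1)] by simp
  then have "odd (card (V - S))" using assms(3) S(2) by simp
  then consider "card S = 1" | "card (V - S) = 1"
    using triv S(2) by (metis One_nat_def le_Suc_eq le_zero_eq even_zero)
  then show ?thesis
  proof cases
    case 1
    then obtain v where "S = {v}" by (meson card_1_singletonE)
    then show ?thesis using deg S(1) by blast
  next
    case 2
    then obtain v where "V - S = {v}" by (meson card_1_singletonE)
    then show ?thesis using deg edge_cut_complement[OF mg S(1)] by (metis Diff_iff singletonI)
  qed
qed

text \<open>
  A vertex of degree at most two lies, with its neighbours, in a set of three vertices spanning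
  weight at least \<open>t\<close>; this forces the odd cut around that set to be tight.
\<close>

lemma degree_ge_3:
  assumes mg: "multigraph V E \<phi>" and w: "odd_cut_weighting V E \<phi> w t"
    and loose: "\<And>S. S \<subseteq> V \<Longrightarrow> odd (card S) \<Longrightarrow> 1 < card S \<Longrightarrow> 1 < card (V - S)
      \<Longrightarrow> sum w (edge_cut E \<phi> S) \<noteq> t"
    and large: "5 \<le> card V" and b: "b \<in> V"
  shows "3 \<le> card (edge_cut E \<phi> {b})"
proof (rule ccontr)
  assume "\<not> 3 \<le> card (edge_cut E \<phi> {b})"
  then have small: "card (edge_cut E \<phi> {b}) \<le> 2" by simp
  let ?C = "edge_cut E \<phi> {b}"
  let ?N = "insert b (\<Union>e\<in>?C. \<phi> e - {b})"
  have finV: "finite V" and finE: "finite E" and ends: "\<And>e. e \<in> E \<Longrightarrow> \<phi> e \<subseteq> V \<and> card (\<phi> e) = 2"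
    using mg unfolding multigraph_def by auto
  have finC: "finite ?C" using finE unfolding edge_cut_def by simp
  have one: "card (\<phi> e - {b}) = 1" if "e \<in> ?C" for e
    using that ends unfolding edge_cut_singleton[OF mg] by simp
  have "card ?N \<le> Suc (card (\<Union>e\<in>?C. \<phi> e - {b}))" by (rule card_insert_le_m1) auto
  also have "card (\<Union>e\<in>?C. \<phi> e - {b}) \<le> (\<Sum>e\<in>?C. card (\<phi> e - {b}))"
    by (rule card_UN_le[OF finC])
  also have "\<dots> = card ?C" using one by simp
  finally have N: "card ?N \<le> 3" using small by simp
  have "?N \<subseteq> V" using b ends unfolding edge_cut_def by blast
  then obtain S where S: "?N \<subseteq> S" "S \<subseteq> V" "card S = 3"
    using exists_subset_between[OF N _ _ finV] large by auto
  have finS: "finite S" using finV S(2) by (rule finite_subset[rotated])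
  \<comment> \<open>Five vertices leave at least two outside \<open>S\<close>, so
    \<open>loose\<close> applies.\<close>
  have "card (V - S) = card V - 3" using card_Diff_subset[OF finS S(2)] S(3) by simp
  then have ne: "sum w (edge_cut E \<phi> S) \<noteq> t" using loose[OF S(2)] S(3) large by simp
  have nonneg: "\<And>e. e \<in> E \<Longrightarrow> 0 \<le> w e" and deg: "\<And>v. v \<in> V \<Longrightarrow> sum w (edge_cut E \<phi> {v}) = t"
    and odd: "t \<le> sum w (edge_cut E \<phi> S)"
    using w S(2,3) unfolding odd_cut_weighting_def by auto
  have "?C \<subseteq> {e \<in> E. \<phi> e \<subseteq> S}"
    using S(1) unfolding edge_cut_def by blast
  then have "sum w ?C \<le> sum w {e \<in> E. \<phi> e \<subseteq> S}"
    using finE nonneg by (intro sum_mono2) auto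
  then have "t \<le> sum w {e \<in> E. \<phi> e \<subseteq> S}" using deg[OF b] by simp
  moreover have "(\<Sum>v\<in>S. sum w (edge_cut E \<phi> {v})) = (\<Sum>v\<in>S. t)"
    using deg S(2) by (intro sum.cong) auto
  \<comment> \<open>Inner weight at least \<open>t\<close> leaves at most \<open>t\<close> for the
    cut, contradicting \<open>odd\<close> and \<open>ne\<close>.\<close>
  then have "3 * t = 2 * sum w {e \<in> E. \<phi> e \<subseteq> S} + sum w (edge_cut E \<phi> S)"
    using handshake[OF mg S(2), of w] S(3) by simp
  ultimately show False using odd ne by simp
qed

text \<open>Counting ends gives twice \<open>card E\<close> at least three times
  \<open>card V\<close>, so the vertex equations of the incidence matrix are
  underdetermined.\<close>

lemma balanced_perturbation_exists:
  assumes mg: "multigraph V E \<phi>" and "V \<noteq> {}"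
    and deg: "\<forall>v\<in>V. 3 \<le> card (edge_cut E \<phi> {v})"
  shows "\<exists>z :: 'e \<Rightarrow> real. (\<exists>e\<in>E. z e \<noteq> 0) \<and> (\<forall>v\<in>V. sum z (edge_cut E \<phi> {v}) = 0)"
proof -
  have finV: "finite V" and finE: "finite E"
    using mg unfolding multigraph_def by auto
  have "{e \<in> E. \<phi> e \<subseteq> V} = E" "edge_cut E \<phi> V = {}"
    using mg unfolding multigraph_def edge_cut_def by blast+
  then have "(\<Sum>v\<in>V. real (card (edge_cut E \<phi> {v}))) = 2 * real (card E)"
    using handshake[OF mg order_refl, of "\<lambda>_. 1"] by simp
  moreover have "(\<Sum>v\<in>V. 3) \<le> (\<Sum>v\<in>V. real (card (edge_cut E \<phi> {v})))"
    using deg by (intro sum_mono) fastforce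
  moreover have "0 < card V" using finV assms(2) by (simp add: card_gt_0_iff)
  ultimately have "card V < card E" by simp
  from underdetermined_system[OF finV finE this, of "\<lambda>v e. if v \<in> \<phi> e then 1 else 0"]
  obtain z :: "'e \<Rightarrow> real" where z: "\<exists>e\<in>E. z e \<noteq> 0"
    "\<forall>v\<in>V. (\<Sum>e\<in>E. (if v \<in> \<phi> e then 1 else 0) * z e) = 0" by blast
  have "(\<Sum>e\<in>E. (if v \<in> \<phi> e then 1 else 0) * z e) = sum z (edge_cut E \<phi> {v})" for v
    unfolding edge_cut_singleton[OF mg] using finE
    by (simp add: sum.inter_filter if_distrib[of "\<lambda>x. x * _"] cong: if_cong)
  then show ?thesis using z by (intro exI[of _ z]) simp
qed

text \<open>A nonnegative \<open>z\<close> with zero sum on every star vanishes on every star, hence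
  on every edge. This makes movement along \<open>z\<close> hit a constraint.\<close>

lemma balanced_negative_entry:
  fixes z :: "'e \<Rightarrow> real"
  assumes mg: "multigraph V E \<phi>" and z: "\<exists>e\<in>E. z e \<noteq> 0"
    and bal: "\<forall>v\<in>V. sum z (edge_cut E \<phi> {v}) = 0"
  shows "\<exists>e\<in>E. z e < 0"
proof (rule ccontr)
  assume "\<not> (\<exists>e\<in>E. z e < 0)"
  then have nonneg: "\<And>e. e \<in> E \<Longrightarrow> 0 \<le> z e" by force
  obtain e where e: "e \<in> E" "z e \<noteq> 0" using z by blast
  have "\<phi> e \<subseteq> V" "card (\<phi> e) = 2" using mg e(1) unfolding multigraph_def by auto
  then have "\<phi> e \<noteq> {}" by auto
  then obtain v where v: "v \<in> V" "v \<in> \<phi> e" using \<open>\<phi> e \<subseteq> V\<close> by blast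
  have "finite {e \<in> E. v \<in> \<phi> e}" using mg unfolding multigraph_def by simp
  then have "z e = 0"
    using bspec[OF bal v(1)] nonneg e(1) v(2) unfolding edge_cut_singleton[OF mg]
    by (subst (asm) sum_nonneg_eq_0_iff) auto
  then show False using e(2) by simp
qed

text \<open>The two situations in which the induction passes to smaller graphs: deletion of an edge
  or contraction along a nontrivial tight odd cut.\<close>

definition degenerate :: "'a set \<Rightarrow> 'e set \<Rightarrow> ('e \<Rightarrow> 'a set) \<Rightarrow> ('e \<Rightarrow> real) \<Rightarrow> real \<Rightarrow> bool" where
  "degenerate V E \<phi> w t \<longleftrightarrow> (\<exists>e\<in>E. w e = 0) \<or>
     (\<exists>S\<subseteq>V. odd (card S) \<and> 1 < card S \<and> 1 < card (V - S) \<and> sum w (edge_cut E \<phi> S) = t)"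

text \<open>Edge weights and slacks of nontrivial odd cuts are affine in \<open>l\<close>; stop at
  the first zero. Trivial odd cuts keep weight \<open>t\<close> because \<open>z\<close> is
  balanced.\<close>

lemma perturb_until_degenerate:
  assumes mg: "multigraph V E \<phi>" and w: "odd_cut_weighting V E \<phi> w t"
    and nd: "\<not> degenerate V E \<phi> w t"
    and z: "\<exists>e\<in>E. z e < 0" and bal: "\<forall>v\<in>V. sum z (edge_cut E \<phi> {v}) = 0"
  obtains l where "0 < l" "odd_cut_weighting V E \<phi> (\<lambda>e. w e + l * z e) t"
    "degenerate V E \<phi> (\<lambda>e. w e + l * z e) t"
proof -
  have finV: "finite V" and finE: "finite E"
    using mg unfolding multigraph_def by auto
  let ?O = "{S. S \<subseteq> V \<and> odd (card S) \<and> 1 < card S \<and> 1 < card (V - S)}"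
  let ?g = "\<lambda>S. (sum w (edge_cut E \<phi> S) - t, sum z (edge_cut E \<phi> S))"
  let ?Q = "(\<lambda>e. (w e, z e)) ` E \<union> ?g ` ?O"
  have nonneg: "\<And>e. e \<in> E \<Longrightarrow> 0 \<le> w e" and deg: "\<And>v. v \<in> V \<Longrightarrow> sum w (edge_cut E \<phi> {v}) = t"
    and ev: "even (card V)"
    and odd: "\<And>S. S \<subseteq> V \<Longrightarrow> odd (card S) \<Longrightarrow> t \<le> sum w (edge_cut E \<phi> S)"
    using w unfolding odd_cut_weighting_def by auto
  have "finite ?O" using finV by simp
  then have finQ: "finite ?Q" using finE by simp
  \<comment> \<open>Nondegeneracy turns all these weak inequalities into strict ones at
    \<open>l = 0\<close>.\<close>
  have posQ: "\<forall>(c, d)\<in>?Q. 0 < c"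
    using nd nonneg odd unfolding degenerate_def by (fastforce simp: less_le)
  obtain p where "p \<in> E" "z p < 0" using z by blast
  with first_zero_of_affine_family[OF finQ posQ, where c' = "w p" and d' = "z p"] obtain l where
    l: "0 < l" "\<forall>(c, d)\<in>?Q. 0 \<le> c + l * d" "\<exists>(c, d)\<in>?Q. c + l * d = 0"
    by blast
  let ?u = "\<lambda>e. w e + l * z e"
  have sum_u: "sum ?u A = sum w A + l * sum z A" for A
    by (simp add: sum.distrib sum_distrib_left)
  have deg_u: "sum ?u (edge_cut E \<phi> {v}) = t" if "v \<in> V" for v
    unfolding sum_u using deg bal that by simp
  have "t \<le> sum ?u (edge_cut E \<phi> S)" if S: "S \<subseteq> V" "odd (card S)" for S
  proof (cases "S \<in> ?O")
    case True
    then have "?g S \<in> ?Q" by blast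
    from bspec[OF l(2) this] show ?thesis unfolding sum_u by simp
  next
    case False
    then have "card S \<le> 1 \<or> card (V - S) \<le> 1" using S by auto
    then show ?thesis using trivial_odd_cut[of V E \<phi> ?u t S] mg deg_u ev S by simp
  qed
  moreover have "0 \<le> ?u e" if "e \<in> E" for e
    using bspec[OF l(2), of "(w e, z e)"] that by simp
  ultimately have "odd_cut_weighting V E \<phi> ?u t"
    using ev deg_u unfolding odd_cut_weighting_def by blast
  moreover have "degenerate V E \<phi> ?u t"
  proof -
    consider e where "e \<in> E" "?u e = 0" | S where "S \<in> ?O" "sum ?u (edge_cut E \<phi> S) = t"
      using l(3) unfolding sum_u by fastforce
    then show ?thesis unfolding degenerate_def by cases blast+
  qed
  ultimately show thesis using l(1) that by blast
qed

section \<open>Graphs with at most four vertices\<close>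

text \<open>On four vertices, the ends of an edge \<open>p\<close> and the other two vertices have
  the same cut and the same degree sum, so by \<open>handshake\<close> equal weight inside. That
  weight is positive, which yields an edge \<open>q\<close> completing \<open>p\<close>.\<close>

lemma small_perfect_matching:
  assumes mg: "multigraph V E \<phi>" and w: "odd_cut_weighting V E \<phi> w t"
    and pos: "\<And>e. e \<in> E \<Longrightarrow> 0 < w e" and "E \<noteq> {}" and small: "card V \<le> 4"
  obtains M where "M \<in> perfect_matchings V E \<phi>" "M \<noteq> {}"
proof -
  have finV: "finite V" and finE: "finite E" and ends: "\<And>e. e \<in> E \<Longrightarrow> \<phi> e \<subseteq> V \<and> card (\<phi> e) = 2"
    using mg unfolding multigraph_def by auto
  have deg: "\<And>v. v \<in> V \<Longrightarrow> sum w (edge_cut E \<phi> {v}) = t" and ev: "even (card V)"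
    using w unfolding odd_cut_weighting_def by auto
  obtain p where p: "p \<in> E" using assms(4) by blast
  let ?S = "\<phi> p"
  have S: "?S \<subseteq> V" "card ?S = 2" using ends p by auto
  have finS: "finite ?S" using finV S(1) by (rule finite_subset[rotated])
  have rest: "card (V - ?S) = card V - 2" using card_Diff_subset[OF finS S(1)] S(2) by simp
  have half: "2 * t = 2 * sum w {e \<in> E. \<phi> e \<subseteq> T} + sum w (edge_cut E \<phi> T)"
    if "T \<subseteq> V" "card T = 2" for T
  proof -
    have "(\<Sum>v\<in>T. sum w (edge_cut E \<phi> {v})) = (\<Sum>v\<in>T. t)"
      using deg that by (intro sum.cong) auto
    then show ?thesis using handshake[OF mg that(1), of w] that(2) by simp
  qed
  have ge2: "2 \<le> card V" using card_mono[OF finV S(1)] S(2) by simp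
  show thesis
  proof (cases "card V = 2")
    case True
    then have "\<phi> p = V" using S finV by (intro card_subset_eq) auto
    then have "{p} \<in> perfect_matchings V E \<phi>" using p unfolding perfect_matchings_def by auto
    then show thesis using that by blast
  next
    case False
    have "card V \<noteq> 3" using ev by auto
    then have "card V = 4" using False small ge2 by simp
    then have T: "card (V - ?S) = 2" using rest by simp
    have "sum w {e \<in> E. \<phi> e \<subseteq> V - ?S} = sum w {e \<in> E. \<phi> e \<subseteq> ?S}"
      using half[OF S] half[OF Diff_subset T] edge_cut_complement[OF mg S(1)] by simp
    also have "0 < sum w {e \<in> E. \<phi> e \<subseteq> ?S}"
      using finE p pos by (intro sum_pos) auto
    finally have "{e \<in> E. \<phi> e \<subseteq> V - ?S} \<noteq> {}" by force
    then obtain q where q: "q \<in> E" "\<phi> q \<subseteq> V - ?S" by blast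
    then have "\<phi> q = V - ?S" using T ends finV by (intro card_subset_eq) auto
    then have "{p, q} \<in> perfect_matchings V E \<phi>"
      using p q(1) unfolding perfect_matchings_def by auto
    then show thesis using that by blast
  qed
qed

text \<open>Take \<open>l\<close> as the least weight on \<open>M\<close>: nothing becomes negative
  and a minimising edge drops to zero. With at most four vertices all odd cuts are trivial, so the
  degrees \<open>t - l\<close> settle the cut conditions.\<close>

lemma peel_until_degenerate:
  assumes mg: "multigraph V E \<phi>" and w: "odd_cut_weighting V E \<phi> w t"
    and small: "card V \<le> 4" and M: "M \<in> perfect_matchings V E \<phi>" "M \<noteq> {}"
  obtains l where "0 \<le> l" "odd_cut_weighting V E \<phi> (\<lambda>e. w e - l * (if e \<in> M then 1 else 0)) (t - l)"
    "degenerate V E \<phi> (\<lambda>e. w e - l * (if e \<in> M then 1 else 0)) (t - l)"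
proof -
  have finV: "finite V" and finE: "finite E" using mg unfolding multigraph_def by auto
  have nonneg: "\<And>e. e \<in> E \<Longrightarrow> 0 \<le> w e" and deg: "\<And>v. v \<in> V \<Longrightarrow> sum w (edge_cut E \<phi> {v}) = t"
    and ev: "even (card V)"
    using w unfolding odd_cut_weighting_def by auto
  have ME: "M \<subseteq> E" using M(1) unfolding perfect_matchings_def by blast
  have finM: "finite (w ` M)" using ME finE finite_subset by blast
  let ?l = "Min (w ` M)"
  let ?u = "\<lambda>e. w e - ?l * (if e \<in> M then 1 else 0)"
  have "?l \<in> w ` M" using finM M(2) by (intro Min_in) auto
  then obtain p where p: "p \<in> M" "?l = w p" by blast
  have min: "?l \<le> w e" if "e \<in> M" for e using finM that by simp
  have l0: "0 \<le> ?l" using p nonneg ME by auto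
  have deg_u: "sum ?u (edge_cut E \<phi> {v}) = t - ?l" if "v \<in> V" for v
    using deg[OF that] sum_indicator_perfect_matching[OF mg M(1) that]
    by (simp only: sum_subtractf sum_distrib_left[symmetric])
  have "sum ?u (edge_cut E \<phi> S) = t - ?l" if S: "S \<subseteq> V" "odd (card S)" for S
  proof (rule trivial_odd_cut[OF mg deg_u ev S])
    have finS: "finite S" using finV S(1) by (rule finite_subset[rotated])
    have "card (V - S) = card V - card S" using card_Diff_subset[OF finS S(1)] .
    moreover have "card S \<noteq> 2" using S(2) by auto
    ultimately show "card S \<le> 1 \<or> card (V - S) \<le> 1" using small by linarith
  qed
  then have "odd_cut_weighting V E \<phi> ?u (t - ?l)"
    using ev deg_u nonneg min unfolding odd_cut_weighting_def by simp
  moreover have "degenerate V E \<phi> ?u (t - ?l)"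
    using p ME unfolding degenerate_def by auto
  ultimately show thesis using that l0 by blast
qed

section \<open>Edmonds' theorem by induction\<close>

theorem odd_cut_weighting_decomposable:
  assumes "multigraph V E \<phi>" "odd_cut_weighting V E \<phi> w t"
  shows "decomposable (perfect_matchings V E \<phi>) E w"
  using assms
proof (induction "card V + card E" arbitrary: V E \<phi> w t rule: less_induct)
  case less
  note mg = less.prems(1)
  have finV: "finite V" and finE: "finite E" using mg unfolding multigraph_def by auto
  let ?P = "perfect_matchings V E \<phi>"
  \<comment> \<open>Stated for arbitrary \<open>u\<close> and \<open>t'\<close> on the fixed graph,
    since it must also cover the peeled and perturbed weightings.\<close>
  have degen: "decomposable ?P E u"
    if u: "odd_cut_weighting V E \<phi> u t'" and dg: "degenerate V E \<phi> u t'" for u t'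
  proof (cases "\<exists>e\<in>E. u e = 0")
    case True
    then obtain p where p: "p \<in> E" "u p = 0" by blast
    have "multigraph V (E - {p}) \<phi>" using mg unfolding multigraph_def by auto
    moreover have "card V + card (E - {p}) < card V + card E"
      using card_Diff1_less[OF finE p(1)] by (rule add_strict_left_mono)
    ultimately have "decomposable (perfect_matchings V (E - {p}) \<phi>) (E - {p}) u"
      using less.hyps odd_cut_weighting_delete[OF mg u p(2)] by blast
    then show ?thesis using decomposable_of_zero_edge[where w = u, OF mg p(2)] by blast
  next
    case False
    then have pos: "0 < u e" if "e \<in> E" for e
      using u that unfolding odd_cut_weighting_def by (simp add: less_le)
    obtain S where S: "S \<subseteq> V" "odd (card S)" "1 < card S" "1 < card (V - S)"
      "sum u (edge_cut E \<phi> S) = t'"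
      using dg False unfolding degenerate_def by blast
    have "S \<noteq> {}" "V - S \<noteq> {}" using S(3,4) by (metis card.empty not_less_zero)+
    then obtain s s' where s: "s \<in> S" "s' \<in> V - S" by blast
    have finS: "finite S" using finV S(1) by (rule finite_subset[rotated])
    have cardV: "card V = card (V - S) + card S"
      using card_Diff_subset[OF finS S(1)] card_mono[OF finV S(1)] by simp
    have odd': "odd (card (V - S))"
      using u S(2) cardV unfolding odd_cut_weighting_def by simp
    have tight': "sum u (edge_cut E \<phi> (V - S)) = t'"
      using S(5) edge_cut_complement[OF mg S(1)] by simp
    have VS: "V - (V - S) = S" using S(1) by blast
    have cE: "card {e \<in> E. Q e} \<le> card E" for Q using finE by (intro card_mono) auto
    \<comment> \<open>Each contracted side has at least two vertices, so a vertex is lost while the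
      number of edges does not grow.\<close>
    have "card (insert s (V - S)) < card V" "card (insert s' (V - (V - S))) < card V"
      using cardV S(3,4) finV finS s unfolding VS by auto
    then have smaller: "card (insert s (V - S)) + card {e \<in> E. \<not> \<phi> e \<subseteq> S} < card V + card E"
      "card (insert s' (V - (V - S))) + card {e \<in> E. \<not> \<phi> e \<subseteq> V - S} < card V + card E"
      using cE by (simp_all add: add_less_le_mono)
    show ?thesis
      by (rule decomposable_of_tight_cut[OF mg pos S(1) s
            less.hyps[OF smaller(1) multigraph_contract[OF mg s(1)]
              odd_cut_weighting_contract[OF mg u S(1) s(1) S(2,5)]]
            less.hyps[OF smaller(2) multigraph_contract[OF mg s(2)]
              odd_cut_weighting_contract[OF mg u Diff_subset s(2) odd' tight']]])
  qed
  show ?case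
  proof (cases "E = {} \<or> degenerate V E \<phi> w t")
    case True
    then show ?thesis using degen[OF less.prems(2)] by (auto simp: decomposable_def)
  next
    case False
    then have E: "E \<noteq> {}" and nd: "\<not> degenerate V E \<phi> w t" by auto
    have pos: "0 < w e" if "e \<in> E" for e
      using nd less.prems(2) that unfolding degenerate_def odd_cut_weighting_def
      by (simp add: less_le)
    show ?thesis
    proof (cases "card V \<le> 4")
      case True
      obtain M where M: "M \<in> ?P" "M \<noteq> {}"
        using small_perfect_matching[OF mg less.prems(2) pos E True] by blast
      obtain l where l: "0 \<le> l"
        "odd_cut_weighting V E \<phi> (\<lambda>e. w e - l * (if e \<in> M then 1 else 0)) (t - l)"
        "degenerate V E \<phi> (\<lambda>e. w e - l * (if e \<in> M then 1 else 0)) (t - l)"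
        using peel_until_degenerate[OF mg less.prems(2) True M] by blast
      \<comment> \<open>Adding \<open>l\<close> times the indicator of \<open>M\<close> to the
        peeled weighting recovers \<open>w\<close>.\<close>
      show ?thesis
        by (rule decomposable_combine[OF degen[OF l(2,3)]
              decomposable_single[OF M(1) finite_perfect_matchings[OF mg]] zero_le_one l(1)]) simp
    next
      case False
      have deg: "\<forall>v\<in>V. 3 \<le> card (edge_cut E \<phi> {v})"
        using degree_ge_3[OF mg less.prems(2)] nd False unfolding degenerate_def by auto
      have "V \<noteq> {}" using False by auto
      from balanced_perturbation_exists[OF mg this deg]
      obtain z :: "_ \<Rightarrow> real" where z: "\<exists>e\<in>E. z e \<noteq> 0"
        "\<forall>v\<in>V. sum z (edge_cut E \<phi> {v}) = 0"
        by blast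
      have step: "\<exists>l>0. decomposable ?P E (\<lambda>e. w e + l * u e)"
        if u: "\<exists>e\<in>E. u e \<noteq> 0" "\<forall>v\<in>V. sum u (edge_cut E \<phi> {v}) = 0" for u
      proof -
        obtain l where l: "0 < l" "odd_cut_weighting V E \<phi> (\<lambda>e. w e + l * u e) t"
          "degenerate V E \<phi> (\<lambda>e. w e + l * u e) t"
          by (rule perturb_until_degenerate[OF mg less.prems(2) nd
                balanced_negative_entry[OF mg u] u(2)])
        show ?thesis using l(1) degen[OF l(2,3)] by blast
      qed
      let ?y = "\<lambda>e. - z e"
      have y: "\<exists>e\<in>E. ?y e \<noteq> 0" "\<forall>v\<in>V. sum ?y (edge_cut E \<phi> {v}) = 0"
        using z by (simp_all add: sum_negf)
      obtain a where a: "0 < a" "decomposable ?P E (\<lambda>e. w e + a * z e)"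
        using step[OF z] by blast
      obtain b where b: "0 < b" "decomposable ?P E (\<lambda>e. w e + b * ?y e)"
        using step[OF y] by blast
      show ?thesis
      proof (rule decomposable_combine[OF a(2) b(2)])
        \<comment> \<open>With these coefficients the shifts \<open>a * z e\<close> and
          \<open>- b * z e\<close> cancel.\<close>
        show "0 \<le> b / (a + b)" "0 \<le> a / (a + b)" using a b by simp_all
        have "a + b \<noteq> 0" using a b by simp
        then show "w e = b / (a + b) * (w e + a * z e) + a / (a + b) * (w e + b * ?y e)" for e
          by (simp add: divide_simps) (simp add: algebra_simps)
      qed
    qed
  qed
qed

section \<open>Application to looms\<close>

lemma PM_eq_perfect_matchings: "PM V E = perfect_matchings V E (\<lambda>e. e)"
  unfolding PM_def perfect_matching_def perfect_matchings_def by simp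

lemma tau_le_card: "cover X H C \<Longrightarrow> tau X H \<le> enat (card C)"
  unfolding tau_def by (rule INF_lower) simp

theorem theorem6p4:
  fixes V :: "'a set" and E :: "'a set set" and r s :: nat
  assumes "r \<ge> 1" and "s \<ge> 1"
    and "simple_graph V E"
    and "regular_graph V E s"
    and "loom E r s (PM V E) (covers_of_size E s (PM V E))"
  shows "(\<exists>f. perfect_fractional_matching E (PM V E) f) \<and>
         (\<exists>g. perfect_fractional_matching E (covers_of_size E s (PM V E)) g)"
proof
  let ?H = "PM V E"
  have tau: "tau E ?H = enat s" and finE: "finite E"
    using assms(5) unfolding loom_def hypergraph_def by auto
  have finV: "finite V" and ends: "\<And>e. e \<in> E \<Longrightarrow> e \<subseteq> V \<and> card e = 2"
    using assms(3) unfolding simple_graph_def by auto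
  have mg: "multigraph V E (\<lambda>e. e)"
    using finE finV ends unfolding multigraph_def by simp
  have odd_cut: "s \<le> card (edge_cut E (\<lambda>e. e) S)" if S: "S \<subseteq> V" "odd (card S)" for S
  proof -
    have "cover E ?H (edge_cut E (\<lambda>e. e) S)"
      using perfect_matching_meets_odd_cut[OF mg _ S]
      unfolding cover_def PM_eq_perfect_matchings by (auto simp: edge_cut_def)
    then have "tau E ?H \<le> enat (card (edge_cut E (\<lambda>e. e) S))" by (rule tau_le_card)
    then show ?thesis using tau by simp
  qed
  have "edge_cut E (\<lambda>e. e) V = {}" using ends unfolding edge_cut_def by blast
  \<comment> \<open>The cut around all of \<open>V\<close> is empty, so an odd \<open>card V\<close>
    would force \<open>s\<close> to be zero.\<close>
  then have "even (card V)" using odd_cut[of V] assms(2) by auto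
  \<comment> \<open>For the constant weight 1, the coefficients of a decomposition sum to 1 at each
    edge, which is a perfect fractional matching.\<close>
  then have "odd_cut_weighting V E (\<lambda>e. e) (\<lambda>_. 1) (real s)"
    using odd_cut assms(4) unfolding odd_cut_weighting_def regular_graph_def
    by (auto simp: edge_cut_singleton[OF mg])
  then have "decomposable ?H E (\<lambda>_. 1)"
    unfolding PM_eq_perfect_matchings by (rule odd_cut_weighting_decomposable[OF mg])
  then show "\<exists>f. perfect_fractional_matching E ?H f"
    unfolding decomposable_def perfect_fractional_matching_def fractional_matching_def by force
next
  let ?B = "covers_of_size E s (PM V E)"
  let ?star = "\<lambda>v. {e \<in> E. v \<in> e}"
  have finE: "finite E" using assms(5) unfolding loom_def hypergraph_def by auto
  have finV: "finite V" and ends: "\<And>e. e \<in> E \<Longrightarrow> e \<subseteq> V \<and> card e = 2"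
    using assms(3) unfolding simple_graph_def by auto
  \<comment> \<open>A perfect matching has an edge at \<open>v\<close>, so the star meets it;
    regularity gives the star size \<open>s\<close>.\<close>
  have star: "?star v \<in> ?B" if "v \<in> V" for v
    using that assms(4) unfolding covers_of_size_def cover_def PM_def perfect_matching_def
      regular_graph_def by blast
  have "finite (Pow E)" using finE by simp
  then have finB: "finite ?B"
    by (rule finite_subset[rotated]) (auto simp: covers_of_size_def cover_def)
  \<comment> \<open>Different vertices may have the same star, for instance the ends of an edge when
    \<open>s = 1\<close>, so each cover is weighted by the number of vertices whose star it
    is.\<close>
  let ?g = "\<lambda>b. real (card {v \<in> V. ?star v = b}) / 2"
  have "(\<Sum>b\<in>{b \<in> ?B. e \<in> b}. ?g b) = 1" if e: "e \<in> E" for e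
  proof -
    have "(\<Sum>b\<in>{b \<in> ?B. e \<in> b}. card {v \<in> V. ?star v = b})
        = card (\<Union>b\<in>{b \<in> ?B. e \<in> b}. {v \<in> V. ?star v = b})"
      using finB finV by (intro card_UN_disjoint[symmetric]) auto
    \<comment> \<open>The vertices whose star contains \<open>e\<close> are its two ends, which
      explains the factor one half.\<close>
    also have "(\<Union>b\<in>{b \<in> ?B. e \<in> b}. {v \<in> V. ?star v = b}) = e"
      using ends[OF e] star e by auto
    finally have "(\<Sum>b\<in>{b \<in> ?B. e \<in> b}. card {v \<in> V. ?star v = b}) = 2"
      using ends[OF e] by simp
    then have "(\<Sum>b\<in>{b \<in> ?B. e \<in> b}. real (card {v \<in> V. ?star v = b})) = 2"
      by (simp flip: of_nat_sum)
    then show ?thesis by (simp flip: sum_divide_distrib)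
  qed
  then show "\<exists>g. perfect_fractional_matching E ?B g"
    unfolding perfect_fractional_matching_def fractional_matching_def by (intro exI[of _ ?g]) auto
qed

end
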